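(* Let $\nu_1,\ldots,\nu_n$ and $\tilde\nu_1,\ldots,\tilde\nu_n$ be probability measures in $\mathcal{P}_2(\mathbb{R})$, let $\lambda_1,\ldots,\lambda_n\in\mathbb{R}$ be (possibly negative) weights such that $\sum_{i=1}^n\lambda_i=1$, and let $\mu$ and $\tilde\mu$ be the generalized barycenters, with weights $\lambda_1,\ldots,\lambda_n$, of $\nu_1,\ldots,\nu_n$ and of $\tilde\nu_1,\ldots,\tilde\nu_n$, respectively. Then $$W_2(\mu,\tilde\mu)\leq\sum_{i=1}^n|\lambda_i|\,W_2(\nu_i,\tilde\nu_i).$$
   Context: $\mathcal{P}_2(\mathbb{R})$ is the set of Borel probability measures on $\mathbb{R}$ with finite second moment, with the 2-Wasserstein distance $W_2$ (quadratic cost). For real weights $\lambda_i$ with $\sum_{i=1}^n\lambda_i=1$ and $\nu_1,\dots,\nu_n\in\mathcal{P}_2(\mathbb{R})$, the generalized barycenter is the (unique) minimizer over $\rho\in\mathcal{P}_2(\mathbb{R})$ of $\rho\mapsto\sum_{i=1}^n\lambda_iW_2^2(\nu_i,\rho)$. *)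

theory Defs
  imports "HOL-Probability.Probability"
begin

definition P2 :: "real measure set" where
  "P2 = {\<nu>. prob_space \<nu> \<and> sets \<nu> = sets borel \<and> integrable \<nu> (\<lambda>x. x\<^sup>2)}"

definition couplings :: "real measure \<Rightarrow> real measure \<Rightarrow> (real \<times> real) measure set" where
  "couplings \<mu> \<nu> = {\<pi>. prob_space \<pi> \<and> sets \<pi> = sets (borel \<Otimes>\<^sub>M borel) \<and>
     distr \<pi> borel fst = \<mu> \<and> distr \<pi> borel snd = \<nu>}"

(* The infimum is taken in ennreal. For \<mu> and \<nu> in P2 it is finite (the product coupling has
   finite cost), so enn2real loses nothing there; outside P2 the value is not meaningful. *)
definition W2 :: "real measure \<Rightarrow> real measure \<Rightarrow> real" where
  "W2 \<mu> \<nu> = sqrt (enn2real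
     (INF \<pi>\<in>couplings \<mu> \<nu>. \<integral>\<^sup>+ p. ennreal ((fst p - snd p)\<^sup>2) \<partial>\<pi>))"

(* \<mu> is a minimizer of \<rho> \<mapsto> (\<Sum>i=1..n. \<lambda>\<^sub>i W2(\<nu>\<^sub>i, \<rho>)^2) over P2. Only minimality is required;
   uniqueness of the minimizer is not part of the definition. *)
definition is_generalized_barycenter ::
    "nat \<Rightarrow> (nat \<Rightarrow> real) \<Rightarrow> (nat \<Rightarrow> real measure) \<Rightarrow> real measure \<Rightarrow> bool" where
  "is_generalized_barycenter n w \<nu> \<mu> \<longleftrightarrow> \<mu> \<in> P2 \<and>
     (\<forall>\<rho>\<in>P2. (\<Sum>i=1..n. w i * (W2 (\<nu> i) \<mu>)\<^sup>2) \<le> (\<Sum>i=1..n. w i * (W2 (\<nu> i) \<rho>)\<^sup>2))"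

end

(* In dimension one the quantile map identifies P2 with the convex cone K of nondecreasing functions
   in L2(0,1), and W2 with the L2 distance. Under this identification the functional defining the
   barycenter is, up to a constant, the squared distance to the function sum_i w_i q_i, where q_i is
   the quantile function of nu_i; negative weights only move this function out of K. The
   barycenter is therefore a metric projection onto K, which is 1-Lipschitz, and the bound follows from
   the triangle inequality. *)
theory Submission
  imports Defs
begin

section \<open>Layer decomposition of the quadratic cost and optimality of comonotone
  couplings\<close>

text \<open>The right-hand side is the area of a half-open square with side between \<open>x\<close>
  and \<open>y\<close>; of the two squares at most one is nonempty. For fixed \<open>z\<close> each
  indicator tests a condition of the form \<open>x <= a\<close>, \<open>b < y\<close>, or the same
  with \<open>x\<close> and \<open>y\<close> exchanged, and such events can be compared between
  couplings.\<close>

lemma square_diff_eq_nn_integral: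
  fixes x y :: real
  shows "ennreal ((x - y)\<^sup>2) = (\<integral>\<^sup>+z. indicator {z. x \<le> min (fst z) (snd z) \<and> max (fst z) (snd z) < y} z
      + indicator {z. y \<le> min (fst z) (snd z) \<and> max (fst z) (snd z) < x} z \<partial>(lborel \<Otimes>\<^sub>M lborel))"
proof -
  have eq: "{z. a \<le> min (fst z) (snd z) \<and> max (fst z) (snd z) < b} = {a..<b} \<times> {a..<b}" for a b :: real
    by auto
  have sq: "emeasure (lborel \<Otimes>\<^sub>M lborel) ({a..<b} \<times> {a..<b}) = ennreal ((max 0 (b - a))\<^sup>2)" for a b :: real
    by (cases "a \<le> b") (simp_all add: lborel.emeasure_pair_measure_Times ennreal_mult power2_eq_square)
  have meas: "{a..<b} \<times> {a..<b} \<in> sets (lborel \<Otimes>\<^sub>M lborel)" for a b :: real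
    by simp
  show ?thesis
    unfolding eq
    by (subst nn_integral_add)
      (use meas in \<open>auto simp: sq max_def power2_commute simp flip: ennreal_plus\<close>)
qed

text \<open>Tonelli turns the transport cost into an integral of masses of sets
  \<open>{f <= a, b < g}\<close> and \<open>{g <= a, b < f}\<close>, so two couplings can be
  compared one set at a time.\<close>

lemma nn_integral_square_diff_layers:
  fixes f g :: "'a \<Rightarrow> real"
  assumes "prob_space M" and [measurable]: "f \<in> borel_measurable M" "g \<in> borel_measurable M"
  shows "(\<integral>\<^sup>+x. ennreal ((f x - g x)\<^sup>2) \<partial>M) =
    (\<integral>\<^sup>+z. emeasure M {x \<in> space M. f x \<le> min (fst z) (snd z) \<and> max (fst z) (snd z) < g x}
      + emeasure M {x \<in> space M. g x \<le> min (fst z) (snd z) \<and> max (fst z) (snd z) < f x}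
      \<partial>(lborel \<Otimes>\<^sub>M lborel))"
proof -
  interpret prob_space M by fact
  interpret T: sigma_finite_measure "lborel \<Otimes>\<^sub>M lborel :: (real \<times> real) measure"
    by (rule lborel_pair.sigma_finite_measure_axioms)
  interpret P: pair_sigma_finite M "lborel \<Otimes>\<^sub>M lborel :: (real \<times> real) measure" ..
  let ?k = "\<lambda>x z. indicator {z. f x \<le> min (fst z) (snd z) \<and> max (fst z) (snd z) < g x} z
      + indicator {z. g x \<le> min (fst z) (snd z) \<and> max (fst z) (snd z) < f x} z :: ennreal"
  have "(\<integral>\<^sup>+x. ennreal ((f x - g x)\<^sup>2) \<partial>M) = (\<integral>\<^sup>+x. (\<integral>\<^sup>+z. ?k x z \<partial>(lborel \<Otimes>\<^sub>M lborel)) \<partial>M)"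
    by (simp only: square_diff_eq_nn_integral)
  also have "\<dots> = (\<integral>\<^sup>+z. (\<integral>\<^sup>+x. ?k x z \<partial>M) \<partial>(lborel \<Otimes>\<^sub>M lborel))"
    by (rule P.Fubini'[symmetric]) (simp add: indicator_def case_prod_beta)
  also have "\<dots> = (\<integral>\<^sup>+z. (\<integral>\<^sup>+x. indicator {x \<in> space M. f x \<le> min (fst z) (snd z) \<and> max (fst z) (snd z) < g x} x
      + indicator {x \<in> space M. g x \<le> min (fst z) (snd z) \<and> max (fst z) (snd z) < f x} x \<partial>M) \<partial>(lborel \<Otimes>\<^sub>M lborel))"
    by (intro nn_integral_cong) (auto simp: indicator_def)
  also have "\<dots> = (\<integral>\<^sup>+z. emeasure M {x \<in> space M. f x \<le> min (fst z) (snd z) \<and> max (fst z) (snd z) < g x}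
      + emeasure M {x \<in> space M. g x \<le> min (fst z) (snd z) \<and> max (fst z) (snd z) < f x}
      \<partial>(lborel \<Otimes>\<^sub>M lborel))"
    by (intro nn_integral_cong) (subst nn_integral_add, auto)
  finally show ?thesis .
qed

text \<open>Level sets of comonotone functions are nested, so the comonotone coupling minimizes the mass
  of every set $\{X \le a,\ Y > b\}$ with given marginals.\<close>

lemma comonotone_emeasure_le:
  fixes f g :: "'a \<Rightarrow> real" and X Y :: "'b \<Rightarrow> real"
  assumes M: "prob_space M" and [measurable]: "f \<in> borel_measurable M" "g \<in> borel_measurable M"
    and N: "prob_space N" and [measurable]: "X \<in> borel_measurable N" "Y \<in> borel_measurable N"
    and X: "distr N borel X = distr M borel f" and Y: "distr N borel Y = distr M borel g"
    and comono: "\<And>x y. x \<in> space M \<Longrightarrow> y \<in> space M \<Longrightarrow> f x < f y \<Longrightarrow> g x \<le> g y"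
  shows "emeasure M {x \<in> space M. f x \<le> a \<and> b < g x} \<le> emeasure N {x \<in> space N. X x \<le> a \<and> b < Y x}"
proof -
  interpret M: prob_space M by fact
  interpret N: prob_space N by fact
  define A B where "A = {x \<in> space M. f x \<le> a}" and "B = {x \<in> space M. g x \<le> b}"
  define A' B' where "A' = {x \<in> space N. X x \<le> a}" and "B' = {x \<in> space N. Y x \<le> b}"
  have [measurable]: "A \<in> sets M" "B \<in> sets M" "A' \<in> sets N" "B' \<in> sets N"
    by (auto simp: A_def B_def A'_def B'_def)
  have "measure (distr N borel X) {..a} = measure (distr M borel f) {..a}"
    and "measure (distr N borel Y) {..b} = measure (distr M borel g) {..b}"
    by (simp_all add: X Y)
  then have eq: "N.prob A' = M.prob A" "N.prob B' = M.prob B"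
    by (simp_all add: measure_distr A_def B_def A'_def B'_def vimage_def Int_def conj_commute)
  \<comment> \<open>Either \<open>A - B\<close> is empty, or it contains some \<open>x\<close>. In
    the latter case every \<open>y\<close> in \<open>B\<close> has \<open>g y <= b < g x\<close>, so
    comonotonicity gives \<open>f y <= f x <= a\<close>. Hence \<open>B\<close> lies in
    \<open>A\<close>, and the mass of \<open>A - B\<close> is a difference of marginal masses, which
    bounds the mass of \<open>A' - B'\<close> from below.\<close>
  have "M.prob (A - B) \<le> N.prob (A' - B')"
  proof (cases "A \<subseteq> B")
    case True
    then have "A - B = {}" by auto
    then show ?thesis by (simp only: measure_empty measure_nonneg)
  next
    case False
    then obtain x where "x \<in> A" "x \<notin> B" by auto
    then have "B \<subseteq> A"
      using comono[of x] by (force simp: A_def B_def)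
    then have "M.prob (A - B) = N.prob A' - N.prob B'"
      by (simp add: M.finite_measure_Diff eq)
    also have "\<dots> \<le> N.prob A' - N.prob (A' \<inter> B')"
      by (simp add: N.finite_measure_mono)
    also have "\<dots> = N.prob (A' - B')"
      by (simp add: N.finite_measure_Diff')
    finally show ?thesis .
  qed
  moreover have "{x \<in> space M. f x \<le> a \<and> b < g x} = A - B" "{x \<in> space N. X x \<le> a \<and> b < Y x} = A' - B'"
    by (auto simp: A_def B_def A'_def B'_def)
  ultimately show ?thesis
    by (simp add: M.emeasure_eq_measure N.emeasure_eq_measure)
qed

text \<open>The joint law of \<open>f\<close> and \<open>g\<close> is itself a coupling, and it
  minimizes the mass of every layer, hence the whole cost.\<close>

lemma W2_comonotone:
  fixes f g :: "'a \<Rightarrow> real"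
  assumes M: "prob_space M" and f[measurable]: "f \<in> borel_measurable M" and g[measurable]: "g \<in> borel_measurable M"
    and comono: "\<And>x y. x \<in> space M \<Longrightarrow> y \<in> space M \<Longrightarrow> f x < f y \<Longrightarrow> g x \<le> g y"
  shows "W2 (distr M borel f) (distr M borel g) = sqrt (\<integral>x. (f x - g x)\<^sup>2 \<partial>M)"
proof -
  interpret M: prob_space M by fact
  let ?C = "couplings (distr M borel f) (distr M borel g)"
  let ?c = "\<lambda>\<pi>. \<integral>\<^sup>+ p. ennreal ((fst p - snd p)\<^sup>2) \<partial>\<pi>"
  let ?I = "\<integral>\<^sup>+x. ennreal ((f x - g x)\<^sup>2) \<partial>M"
  let ?\<pi> = "distr M (borel \<Otimes>\<^sub>M borel) (\<lambda>x. (f x, g x))"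
  have \<pi>: "?\<pi> \<in> ?C"
    by (auto simp: couplings_def distr_distr comp_def intro!: M.prob_space_distr)
  have "?c ?\<pi> = ?I"
    by (simp add: nn_integral_distr)
  moreover have "?I \<le> ?c \<pi>" if "\<pi> \<in> ?C" for \<pi>
  proof -
    have \<pi>: "prob_space \<pi>" and sets[measurable_cong]: "sets \<pi> = sets (borel \<Otimes>\<^sub>M borel)"
      and marg: "distr \<pi> borel fst = distr M borel f" "distr \<pi> borel snd = distr M borel g"
      using that by (auto simp: couplings_def)
    have [measurable]: "fst \<in> borel_measurable \<pi>" "snd \<in> borel_measurable \<pi>"
      by simp_all
    \<comment> \<open>The second family of layers has \<open>f\<close> and \<open>g\<close>
      exchanged, so comonotonicity is also needed in the exchanged form, which is its
      contrapositive.\<close>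
    have comono': "f x \<le> f y" if "x \<in> space M" "y \<in> space M" "g x < g y" for x y
      using comono[of y x] that by force
    show ?thesis
      unfolding nn_integral_square_diff_layers[OF M f g]
        nn_integral_square_diff_layers[OF \<pi> \<open>fst \<in> borel_measurable \<pi>\<close> \<open>snd \<in> borel_measurable \<pi>\<close>]
      using M \<pi> marg comono comono'
      by (intro nn_integral_mono add_mono comonotone_emeasure_le) auto
  qed
  ultimately have "(INF \<pi>\<in>?C. ?c \<pi>) = ?I"
    using \<pi> by (intro antisym INF_greatest) (auto intro: INF_lower2)
  \<comment> \<open>If \<open>?I\<close> is infinite, \<open>enn2real\<close> and the Bochner
    integral both return 0, so the equality holds in that case too.\<close>
  then show ?thesis
    by (simp add: W2_def integral_eq_nn_integral)
qed

section \<open>Inner products of square-integrable functions\<close>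

lemma Cauchy_Schwarz_integral:
  fixes f g :: "'a \<Rightarrow> real"
  assumes f: "integrable M (\<lambda>x. (f x)\<^sup>2)" and g: "integrable M (\<lambda>x. (g x)\<^sup>2)"
    and fg: "integrable M (\<lambda>x. f x * g x)"
  shows "\<bar>\<integral>x. f x * g x \<partial>M\<bar> \<le> sqrt (\<integral>x. (f x)\<^sup>2 \<partial>M) * sqrt (\<integral>x. (g x)\<^sup>2 \<partial>M)"
proof -
  let ?A = "\<integral>x. (f x)\<^sup>2 \<partial>M" and ?B = "\<integral>x. (g x)\<^sup>2 \<partial>M" and ?C = "\<integral>x. f x * g x \<partial>M"
  have quad: "0 \<le> s\<^sup>2 * ?A - 2 * s * t * ?C + t\<^sup>2 * ?B" for s t
  proof -
    have "0 \<le> (\<integral>x. (s * f x - t * g x)\<^sup>2 \<partial>M)"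
      by simp
    also have "(\<lambda>x. (s * f x - t * g x)\<^sup>2) = (\<lambda>x. s\<^sup>2 * (f x)\<^sup>2 - 2 * s * t * (f x * g x) + t\<^sup>2 * (g x)\<^sup>2)"
      by (simp add: power2_eq_square algebra_simps)
    also have "(\<integral>x. s\<^sup>2 * (f x)\<^sup>2 - 2 * s * t * (f x * g x) + t\<^sup>2 * (g x)\<^sup>2 \<partial>M) = s\<^sup>2 * ?A - 2 * s * t * ?C + t\<^sup>2 * ?B"
      using f g fg by simp
    finally show ?thesis .
  qed
  have nn: "0 \<le> ?A" "0 \<le> ?B" by simp_all
  have "?C\<^sup>2 \<le> ?A * ?B"
  proof (cases "?A = 0")
    case True
    have "?C = 0"
    proof (rule ccontr)
      assume "?C \<noteq> 0"
      \<comment> \<open>With \<open>?A = 0\<close> this choice of \<open>s\<close> and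
        \<open>t\<close> gives the form the value -1.\<close>
      with quad[of "(?B + 1) / (2 * ?C)" 1] True show False
        by (simp add: field_simps)
    qed
    then show ?thesis using True by simp
  next
    case False
    with nn have "0 < ?A" by linarith
    have "0 \<le> ?A * (?A * ?B - ?C\<^sup>2)"
      \<comment> \<open>At \<open>s = ?C\<close>, \<open>t = ?A\<close> the form equals
        \<open>?A * (?A * ?B - ?C^2)\<close>.\<close>
      using quad[of ?C ?A] by (simp add: power2_eq_square algebra_simps)
    with \<open>0 < ?A\<close> show ?thesis
      by (simp add: zero_le_mult_iff)
  qed
  then have "sqrt (?C\<^sup>2) \<le> sqrt (?A * ?B)"
    by (rule real_sqrt_le_mono)
  then show ?thesis
    by (simp add: real_sqrt_mult)
qed

lemma integrable_mult_L2:
  fixes f g :: "'a \<Rightarrow> real"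
  assumes [measurable]: "f \<in> borel_measurable M" "g \<in> borel_measurable M"
    and "integrable M (\<lambda>x. (f x)\<^sup>2)" "integrable M (\<lambda>x. (g x)\<^sup>2)"
  shows "integrable M (\<lambda>x. f x * g x)"
proof (rule Bochner_Integration.integrable_bound[where f="\<lambda>x. (f x)\<^sup>2 + (g x)\<^sup>2"])
  have "\<bar>a * b\<bar> \<le> a\<^sup>2 + b\<^sup>2" for a b :: real
    using sum_squares_bound[of "\<bar>a\<bar>" "\<bar>b\<bar>"] mult_nonneg_nonneg[of "\<bar>a\<bar>" "\<bar>b\<bar>"]
    unfolding abs_mult power2_abs by linarith
  then show "AE x in M. norm (f x * g x) \<le> norm ((f x)\<^sup>2 + (g x)\<^sup>2)"
    by auto
qed (use assms in auto)

section \<open>Quantile functions on the unit interval\<close>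

abbreviation unit_space :: "real measure" where
  "unit_space \<equiv> restrict_space lborel {0<..<1}"

text \<open>The interval is open because quantile functions of measures with unbounded support
  diverge at an endpoint. Elements are functions rather than classes modulo null sets, so a measure
  may have several representatives.\<close>

definition monotone_L2 :: "(real \<Rightarrow> real) set" where
  "monotone_L2 = {q. q \<in> borel_measurable unit_space \<and> mono_on {0<..<1} q \<and> integrable unit_space (\<lambda>x. (q x)\<^sup>2)}"

lemma prob_space_unit: "prob_space unit_space"
  by (auto simp: space_restrict_space emeasure_restrict_space intro!: prob_spaceI)

lemma space_unit: "space unit_space = {0<..<1}"
  by (simp add: space_restrict_space)

lemma P2_quantile:
  assumes "\<nu> \<in> P2"
  obtains q where "q \<in> monotone_L2" "\<nu> = distr unit_space borel q"
proof -
  have \<nu>: "prob_space \<nu>" "sets \<nu> = sets borel" "integrable \<nu> (\<lambda>x. x\<^sup>2)"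
    using assms by (auto simp: P2_def)
  \<comment> \<open>In this locale \<open>I\<close> is the generalized inverse of the distribution
    function; it pushes the uniform law forward to the given measure.\<close>
  then interpret cdf_distribution \<nu>
    by (simp add: cdf_distribution_def real_distribution_def real_distribution_axioms_def)
  have I[measurable]: "I \<in> borel_measurable unit_space"
    using measurable_CI by (simp cong: measurable_cong_sets)
  have "integrable (distr unit_space borel I) (\<lambda>x. x\<^sup>2)"
    using \<nu>(3) by (simp add: distr_I_eq_M)
  then have "integrable unit_space (\<lambda>x. (I x)\<^sup>2)"
    by (simp add: integrable_distr_eq)
  then have "I \<in> monotone_L2"
    using I mono_I by (simp add: monotone_L2_def)
  then show ?thesis
    using that distr_I_eq_M by metis
qed

lemma distr_monotone_L2_in_P2:
  assumes "q \<in> monotone_L2"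
  shows "distr unit_space borel q \<in> P2"
  using assms prob_space.prob_space_distr[OF prob_space_unit]
  by (auto simp: monotone_L2_def P2_def integrable_distr_eq)

text \<open>Any two nondecreasing functions are comonotone, so the one space (0,1) couples all
  measures optimally at the same time. This makes the barycenter functional quadratic in the
  quantile function.\<close>

lemma W2_distr_monotone_L2:
  assumes p: "p \<in> monotone_L2" and q: "q \<in> monotone_L2"
  shows "W2 (distr unit_space borel p) (distr unit_space borel q) = sqrt (\<integral>x. (p x - q x)\<^sup>2 \<partial>unit_space)"
proof (rule W2_comonotone[OF prob_space_unit])
  fix x y assume "x \<in> space unit_space" "y \<in> space unit_space" "p x < p y"
  then show "q x \<le> q y"
    using p q unfolding monotone_L2_def space_unit mono_on_def mem_Collect_eq
    by (metis linorder_le_cases not_le)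
qed (use p q in \<open>auto simp: monotone_L2_def\<close>)

text \<open>Makes the segment from a minimizer to any other element available as a family of
  competitors.\<close>

lemma monotone_L2_convex:
  assumes "p \<in> monotone_L2" "q \<in> monotone_L2" "0 \<le> t" "t \<le> 1"
  shows "(\<lambda>x. p x + t * (q x - p x)) \<in> monotone_L2"
proof -
  have [measurable]: "p \<in> borel_measurable unit_space" "q \<in> borel_measurable unit_space"
    using assms by (auto simp: monotone_L2_def)
  have sq: "(\<lambda>x. (p x + t * (q x - p x))\<^sup>2) =
      (\<lambda>x. (1 - t)\<^sup>2 * (p x)\<^sup>2 + 2 * t * (1 - t) * (p x * q x) + t\<^sup>2 * (q x)\<^sup>2)"
    by (simp add: power2_eq_square algebra_simps)
  have "integrable unit_space (\<lambda>x. (p x + t * (q x - p x))\<^sup>2)"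
    unfolding sq using assms
    by (auto intro!: Bochner_Integration.integrable_add integrable_mult_right integrable_mult_L2 simp: monotone_L2_def)
  moreover have "mono_on {0<..<1} (\<lambda>x. p x + t * (q x - p x))"
  proof (rule mono_onI)
    fix x y :: real assume *: "x \<in> {0<..<1}" "y \<in> {0<..<1}" "x \<le> y"
    then have "p x \<le> p y" "q x \<le> q y"
      using assms by (auto simp: monotone_L2_def mono_on_def)
    then have "(1 - t) * p x + t * q x \<le> (1 - t) * p y + t * q y"
      using assms by (intro add_mono mult_left_mono) auto
    then show "p x + t * (q x - p x) \<le> p y + t * (q y - p y)"
      by (simp add: algebra_simps)
  qed
  ultimately show ?thesis
    by (simp add: monotone_L2_def)
qed

lemma integrable_square_diff:
  assumes "p \<in> monotone_L2" "q \<in> monotone_L2"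
  shows "integrable unit_space (\<lambda>x. (p x - q x)\<^sup>2)"
proof -
  have sq: "(\<lambda>x. (p x - q x)\<^sup>2) = (\<lambda>x. (p x)\<^sup>2 - 2 * (p x * q x) + (q x)\<^sup>2)"
    by (simp add: power2_eq_square algebra_simps)
  show ?thesis
    unfolding sq using assms
    by (intro Bochner_Integration.integrable_add Bochner_Integration.integrable_diff
        integrable_mult_right integrable_mult_L2) (auto simp: monotone_L2_def)
qed

lemma integrable_diff_mult_diff:
  assumes "p \<in> monotone_L2" "q \<in> monotone_L2" "p' \<in> monotone_L2" "q' \<in> monotone_L2"
  shows "integrable unit_space (\<lambda>x. (p x - q x) * (p' x - q' x))"
  using assms
  by (intro integrable_mult_L2 integrable_square_diff) (auto simp: monotone_L2_def)

section \<open>First-order condition and stability of the barycenter\<close>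

text \<open>The first-order condition for $q$ to be the metric projection of $\sum_i w_i q_i$ onto the
  convex cone of nondecreasing functions, tested in the direction $r - q$.\<close>

lemma barycenter_variational:
  assumes qi: "\<And>i. i \<in> {1..n} \<Longrightarrow> p i \<in> monotone_L2" and q: "q \<in> monotone_L2" and r: "r \<in> monotone_L2"
    and \<nu>: "\<And>i. i \<in> {1..n} \<Longrightarrow> \<nu> i = distr unit_space borel (p i)"
    and w: "(\<Sum>i=1..n. w i) = 1"
    and bary: "is_generalized_barycenter n w \<nu> (distr unit_space borel q)"
  shows "(\<Sum>i=1..n. w i * (\<integral>x. (p i x - q x) * (r x - q x) \<partial>unit_space)) \<le> 0"
    (is "?S \<le> 0")
proof -
  let ?D = "\<integral>x. (r x - q x)\<^sup>2 \<partial>unit_space"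
  \<comment> \<open>Minimality against the competitor \<open>?h\<close> on the segment from
    \<open>q\<close> to \<open>r\<close>, divided by \<open>t\<close>. Letting \<open>t\<close> tend
    to 0 from the right then removes the quadratic term.\<close>
  have bound: "2 * ?S \<le> t * ?D" if t: "0 < t" "t \<le> 1" for t
  proof -
    let ?h = "\<lambda>x. q x + t * (r x - q x)"
    have h: "?h \<in> monotone_L2"
      using monotone_L2_convex[OF q r] t by simp
    have W2: "(\<Sum>i=1..n. w i * (W2 (\<nu> i) (distr unit_space borel s))\<^sup>2)
        = (\<Sum>i=1..n. w i * (\<integral>x. (p i x - s x)\<^sup>2 \<partial>unit_space))" if "s \<in> monotone_L2" for s
      using that qi \<nu> by (intro sum.cong refl) (simp add: W2_distr_monotone_L2)
    have expand: "(\<integral>x. (p i x - ?h x)\<^sup>2 \<partial>unit_space) = (\<integral>x. (p i x - q x)\<^sup>2 \<partial>unit_space)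
        - 2 * t * (\<integral>x. (p i x - q x) * (r x - q x) \<partial>unit_space) + t\<^sup>2 * ?D" if i: "i \<in> {1..n}" for i
    proof -
      have "(\<lambda>x. (p i x - ?h x)\<^sup>2) =
          (\<lambda>x. (p i x - q x)\<^sup>2 - 2 * t * ((p i x - q x) * (r x - q x)) + t\<^sup>2 * (r x - q x)\<^sup>2)"
        by (simp add: power2_eq_square algebra_simps)
      then show ?thesis
        using integrable_square_diff[OF qi[OF i] q] integrable_square_diff[OF r q]
          integrable_diff_mult_diff[OF qi[OF i] q r q] by simp
    qed
    have "(\<Sum>i=1..n. w i * (\<integral>x. (p i x - q x)\<^sup>2 \<partial>unit_space)) \<le> (\<Sum>i=1..n. w i * (\<integral>x. (p i x - ?h x)\<^sup>2 \<partial>unit_space))"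
      using bary distr_monotone_L2_in_P2[OF h]
      unfolding is_generalized_barycenter_def W2[OF q, symmetric] W2[OF h, symmetric] by blast
    also have "\<dots> = (\<Sum>i=1..n. w i * (\<integral>x. (p i x - q x)\<^sup>2 \<partial>unit_space)
        - 2 * t * (w i * (\<integral>x. (p i x - q x) * (r x - q x) \<partial>unit_space)) + t\<^sup>2 * ?D * w i)"
      by (intro sum.cong refl, subst expand) (auto simp: algebra_simps)
    \<comment> \<open>The coefficient \<open>?D\<close> of the quadratic term does not depend on
      \<open>i\<close>, so whatever the signs of the weights, their sum 1 is all that
      enters.\<close>
    also have "\<dots> = (\<Sum>i=1..n. w i * (\<integral>x. (p i x - q x)\<^sup>2 \<partial>unit_space)) - 2 * t * ?S + t\<^sup>2 * ?D"
      by (simp only: sum.distrib sum_subtractf sum_distrib_left[symmetric] w mult_1_right)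
    finally have "t * (2 * ?S) \<le> t * (t * ?D)"
      by (simp add: power2_eq_square algebra_simps)
    then show ?thesis
      using t by simp
  qed
  have "((\<lambda>t. t * ?D) \<longlongrightarrow> 0 * ?D) (at_right 0)"
    by (intro tendsto_intros)
  moreover have "\<forall>\<^sub>F t in at_right 0. 2 * ?S \<le> t * ?D"
    by (rule eventually_at_rightI[of 0 1]) (use bound in \<open>simp_all del: One_nat_def\<close>)
  ultimately have "2 * ?S \<le> 0 * ?D"
    by (rule tendsto_lowerbound) simp
  then show ?thesis by simp
qed

theorem lemma3p4:
  fixes n :: nat
    and w :: "nat \<Rightarrow> real"
    and \<nu> \<nu>' :: "nat \<Rightarrow> real measure"
    and \<mu> \<mu>' :: "real measure"
  assumes "\<And>i. i \<in> {1..n} \<Longrightarrow> \<nu> i \<in> P2"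
    and "\<And>i. i \<in> {1..n} \<Longrightarrow> \<nu>' i \<in> P2"
    and "(\<Sum>i=1..n. w i) = 1"
    and "is_generalized_barycenter n w \<nu> \<mu>"
    and "is_generalized_barycenter n w \<nu>' \<mu>'"
  shows "W2 \<mu> \<mu>' \<le> (\<Sum>i=1..n. \<bar>w i\<bar> * W2 (\<nu> i) (\<nu>' i))"
proof -
  have "\<exists>p. \<forall>i\<in>{1..n}. p i \<in> monotone_L2 \<and> \<nu> i = distr unit_space borel (p i)"
    using assms(1) P2_quantile by (intro bchoice) metis
  then obtain p where p: "\<And>i. i \<in> {1..n} \<Longrightarrow> p i \<in> monotone_L2"
    and \<nu>: "\<And>i. i \<in> {1..n} \<Longrightarrow> \<nu> i = distr unit_space borel (p i)" by blast
  have "\<exists>p. \<forall>i\<in>{1..n}. p i \<in> monotone_L2 \<and> \<nu>' i = distr unit_space borel (p i)"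
    using assms(2) P2_quantile by (intro bchoice) metis
  then obtain p' where p': "\<And>i. i \<in> {1..n} \<Longrightarrow> p' i \<in> monotone_L2"
    and \<nu>': "\<And>i. i \<in> {1..n} \<Longrightarrow> \<nu>' i = distr unit_space borel (p' i)" by blast
  obtain q where q: "q \<in> monotone_L2" and \<mu>: "\<mu> = distr unit_space borel q"
    using assms(4) P2_quantile by (auto simp: is_generalized_barycenter_def)
  obtain q' where q': "q' \<in> monotone_L2" and \<mu>': "\<mu>' = distr unit_space borel q'"
    using assms(5) P2_quantile by (auto simp: is_generalized_barycenter_def)
  let ?d = "W2 \<mu> \<mu>'"
  have d: "?d = sqrt (\<integral>x. (q x - q' x)\<^sup>2 \<partial>unit_space)"
    using W2_distr_monotone_L2[OF q q'] \<mu> \<mu>' by simp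
  have W2i: "W2 (\<nu> i) (\<nu>' i) = sqrt (\<integral>x. (p i x - p' i x)\<^sup>2 \<partial>unit_space)" if "i \<in> {1..n}" for i
    using W2_distr_monotone_L2[OF p p'] \<nu> \<nu>' that by simp
  \<comment> \<open>Write \<open>p i - p' i\<close> as
    \<open>(q - q') + (p i - q) - (p' i - q')\<close>. The signs are arranged so that the cross
    terms are those of the first-order conditions at \<open>q\<close> in direction
    \<open>q' - q\<close> and at \<open>q'\<close> in direction \<open>q - q'\<close>. Working index
    by index, the proof never forms the weighted sums of the \<open>p i\<close> and
    \<open>p' i\<close>.\<close>
  have split: "(\<integral>x. (p i x - p' i x) * (q x - q' x) \<partial>unit_space) =
      (\<integral>x. (q x - q' x)\<^sup>2 \<partial>unit_space)
      - (\<integral>x. (p i x - q x) * (q' x - q x) \<partial>unit_space)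
      - (\<integral>x. (p' i x - q' x) * (q x - q' x) \<partial>unit_space)" if i: "i \<in> {1..n}" for i
  proof -
    have "(\<lambda>x. (p i x - p' i x) * (q x - q' x)) = (\<lambda>x. (q x - q' x)\<^sup>2 - (p i x - q x) * (q' x - q x)
        - (p' i x - q' x) * (q x - q' x))"
      by (simp add: power2_eq_square algebra_simps)
    then show ?thesis
      using integrable_square_diff[OF q q'] integrable_diff_mult_diff[OF p[OF i] q q' q]
        integrable_diff_mult_diff[OF p'[OF i] q' q q'] by simp
  qed
  have "(\<Sum>i=1..n. w i * (\<integral>x. (p i x - q x) * (q' x - q x) \<partial>unit_space)) \<le> 0"
    using p q q' \<nu> assms(3) assms(4)[unfolded \<mu>] by (rule barycenter_variational)
  moreover have "(\<Sum>i=1..n. w i * (\<integral>x. (p' i x - q' x) * (q x - q' x) \<partial>unit_space)) \<le> 0"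
    using p' q' q \<nu>' assms(3) assms(5)[unfolded \<mu>'] by (rule barycenter_variational)
  \<comment> \<open>The factor 1 is written as the sum of the weights so that \<open>split\<close>
    can be applied term by term.\<close>
  moreover have "?d\<^sup>2 = (\<Sum>i=1..n. w i) * (\<integral>x. (q x - q' x)\<^sup>2 \<partial>unit_space)"
    unfolding assms(3) d by simp
  ultimately have "?d\<^sup>2 \<le> (\<Sum>i=1..n. w i) * (\<integral>x. (q x - q' x)\<^sup>2 \<partial>unit_space)
      - (\<Sum>i=1..n. w i * (\<integral>x. (p i x - q x) * (q' x - q x) \<partial>unit_space))
      - (\<Sum>i=1..n. w i * (\<integral>x. (p' i x - q' x) * (q x - q' x) \<partial>unit_space))"
    by linarith
  also have "\<dots> = (\<Sum>i=1..n. w i * (\<integral>x. (p i x - p' i x) * (q x - q' x) \<partial>unit_space))"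
  proof -
    have distrib: "a * x - a * y - a * z = a * (x - y - z)" for a x y z :: real
      by (simp add: algebra_simps)
    show ?thesis
      unfolding sum_distrib_right sum_subtractf[symmetric] distrib
      by (rule sum.cong[OF refl]) (simp only: split)
  qed
  also have "\<dots> \<le> (\<Sum>i=1..n. \<bar>w i\<bar> * W2 (\<nu> i) (\<nu>' i) * ?d)"
  proof (rule sum_mono)
    fix i assume i: "i \<in> {1..n}"
    \<comment> \<open>Absolute values of the weights enter only here, where each inner product is
      bounded by Cauchy-Schwarz.\<close>
    have "w i * (\<integral>x. (p i x - p' i x) * (q x - q' x) \<partial>unit_space)
        \<le> \<bar>w i\<bar> * \<bar>\<integral>x. (p i x - p' i x) * (q x - q' x) \<partial>unit_space\<bar>"
      unfolding abs_mult[symmetric] by (rule abs_ge_self)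
    also have "\<dots> \<le> \<bar>w i\<bar> * (W2 (\<nu> i) (\<nu>' i) * ?d)"
      unfolding W2i[OF i] d
      by (intro mult_left_mono abs_ge_zero Cauchy_Schwarz_integral[OF integrable_square_diff[OF p[OF i] p'[OF i]]
            integrable_square_diff[OF q q'] integrable_diff_mult_diff[OF p[OF i] p'[OF i] q q']])
    finally show "w i * (\<integral>x. (p i x - p' i x) * (q x - q' x) \<partial>unit_space) \<le> \<bar>w i\<bar> * W2 (\<nu> i) (\<nu>' i) * ?d"
      by (simp add: mult.assoc)
  qed
  finally have "?d * ?d \<le> (\<Sum>i=1..n. \<bar>w i\<bar> * W2 (\<nu> i) (\<nu>' i)) * ?d"
    by (simp add: power2_eq_square sum_distrib_right)
  moreover have "0 \<le> ?d" and "0 \<le> (\<Sum>i=1..n. \<bar>w i\<bar> * W2 (\<nu> i) (\<nu>' i))"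
    by (auto simp: W2_def intro!: sum_nonneg)
  ultimately show ?thesis
    \<comment> \<open>For \<open>?d = 0\<close> the right-hand side is nonnegative; otherwise
      \<open>?d\<close> cancels.\<close>
    by (cases "?d = 0") auto
qed

end
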